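(* Let $1\le s\le t$ be fixed integers and let $n\ge t$. Then \[ sat(K_{n,n},K_{s,t}) \ge (s+t-2)n-(s+t-2)^2 . \] Equivalently, every $K_{s,t}$-saturated $n$-by-$n$ bipartite graph has at least $(s+t-2)n-(s+t-2)^2$ edges.
   Context: An $n$-by-$n$ bipartite graph $G$ has fixed vertex classes $U$ and $U'$ with $|U|=|U'|=n$, and all edges go between $U$ and $U'$. A copy of $K_{s,t}$ in such a graph is unordered: it may have $s$ vertices in $U$ and $t$ in $U'$, or $t$ vertices in $U$ and $s$ in $U'$. $G$ is $K_{s,t}$-saturated if it contains no copy of $K_{s,t}$, but adding any missing edge $uu'$ with $u\in U$ and $u'\in U'$ creates a new copy of $K_{s,t}$, that is, a copy containing the edge $uu'$. The saturation number $sat(K_{n,n},K_{s,t})$ is the minimum number of edges in a $K_{s,t}$-saturated $n$-by-$n$ bipartite graph. *)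

theory Defs
  imports Main
begin

text \<open>
  A bipartite graph with fixed vertex classes \<open>U\<close> and \<open>U'\<close> is given by its edge set
  \<open>E \<subseteq> U \<times> U'\<close>: the pair \<open>(u, u')\<close> stands for the edge joining \<open>u \<in> U\<close> to \<open>u' \<in> U'\<close>.
  The position in the pair records the class, so \<open>U\<close> and \<open>U'\<close> need not be disjoint as sets;
  in particular both may be \<open>{..<n}\<close>.
\<close>

definition bipartite_graph :: "nat \<Rightarrow> 'a set \<Rightarrow> 'b set \<Rightarrow> ('a \<times> 'b) set \<Rightarrow> bool" where
  "bipartite_graph n U U' E \<longleftrightarrow>
     finite U \<and> finite U' \<and> card U = n \<and> card U' = n \<and> E \<subseteq> U \<times> U'"

text \<open>
  A copy of \<open>K\<^sub>s\<^sub>,\<^sub>t\<close> is identified with its two sides \<open>A \<subseteq> U\<close> and \<open>B \<subseteq> U'\<close>. It is unordered: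
  either side may be the one of size \<open>s\<close>.
\<close>

definition biclique_copy ::
  "nat \<Rightarrow> nat \<Rightarrow> 'a set \<Rightarrow> 'b set \<Rightarrow> ('a \<times> 'b) set \<Rightarrow> 'a set \<Rightarrow> 'b set \<Rightarrow> bool" where
  "biclique_copy s t U U' E A B \<longleftrightarrow>
     A \<subseteq> U \<and> B \<subseteq> U' \<and> A \<times> B \<subseteq> E \<and>
     (card A = s \<and> card B = t \<or> card A = t \<and> card B = s)"

definition biclique_saturated ::
  "nat \<Rightarrow> nat \<Rightarrow> 'a set \<Rightarrow> 'b set \<Rightarrow> ('a \<times> 'b) set \<Rightarrow> bool" where
  "biclique_saturated s t U U' E \<longleftrightarrow>
     (\<nexists>A B. biclique_copy s t U U' E A B) \<and>
     (\<forall>u\<in>U. \<forall>u'\<in>U'. (u, u') \<notin> E \<longrightarrow>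
        (\<exists>A B. biclique_copy s t U U' (insert (u, u') E) A B \<and> u \<in> A \<and> u' \<in> B))"

text \<open>
  The graphs on the labelled classes \<open>{..<n}\<close> represent all \<open>n\<close>-by-\<open>n\<close> bipartite graphs up to
  isomorphism. The minimum is over a finite set, nonempty for \<open>s, t \<ge> 1\<close>
  (lemmas \<open>finite_saturated_sizes\<close> and \<open>saturated_sizes_nonempty\<close>).
\<close>

definition saturated_sizes :: "nat \<Rightarrow> nat \<Rightarrow> nat \<Rightarrow> nat set" where
  "saturated_sizes n s t =
     {card E | E :: (nat \<times> nat) set.
        bipartite_graph n {..<n} {..<n} E \<and> biclique_saturated s t {..<n} {..<n} E}"

definition sat_number :: "nat \<Rightarrow> nat \<Rightarrow> nat \<Rightarrow> nat" where
  "sat_number n s t = Min (saturated_sizes n s t)"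

lemma finite_saturated_sizes: "finite (saturated_sizes n s t)"
proof -
  have "saturated_sizes n s t \<subseteq> card ` Pow ({..<n} \<times> {..<n})"
    by (auto simp: saturated_sizes_def bipartite_graph_def)
  then show ?thesis
    by (rule finite_subset) simp
qed

lemma saturated_sizes_nonempty:
  assumes "1 \<le> s" "1 \<le> t"
  shows "saturated_sizes n s t \<noteq> {}"
proof -
  let ?U = "{..<n}"
  let ?free = "\<lambda>E. \<nexists>A B. biclique_copy s t ?U ?U E A B"
  let ?F = "{E. E \<subseteq> ?U \<times> ?U \<and> ?free E}"
  have "finite ?F"
    by (rule finite_subset[of _ "Pow (?U \<times> ?U)"]) auto
  moreover have "?free {}"
    using assms by (auto simp: biclique_copy_def)
  then have "?F \<noteq> {}"
    by blast
  ultimately obtain E where E: "E \<in> ?F" and max: "\<And>E'. E' \<in> ?F \<Longrightarrow> E \<subseteq> E' \<Longrightarrow> E = E'"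
    using finite_has_maximal[of ?F] by force
  have "\<exists>A B. biclique_copy s t ?U ?U (insert (u, v) E) A B \<and> u \<in> A \<and> v \<in> B"
    if uv: "u \<in> ?U" "v \<in> ?U" "(u, v) \<notin> E" for u v
  proof -
    have "insert (u, v) E \<notin> ?F"
      using max[of "insert (u, v) E"] \<open>(u, v) \<notin> E\<close> by auto
    moreover have "insert (u, v) E \<subseteq> ?U \<times> ?U"
      using E uv by simp
    ultimately obtain A B where AB: "biclique_copy s t ?U ?U (insert (u, v) E) A B"
      by auto
    have "\<not> A \<times> B \<subseteq> E"
    proof
      assume "A \<times> B \<subseteq> E"
      with AB have "biclique_copy s t ?U ?U E A B"
        by (simp add: biclique_copy_def)
      with E show False
        by simp
    qed
    moreover have "A \<times> B \<subseteq> insert (u, v) E"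
      using AB by (simp add: biclique_copy_def)
    ultimately have "u \<in> A" "v \<in> B"
      by auto
    with AB show ?thesis
      by blast
  qed
  then have "biclique_saturated s t ?U ?U E"
    using E by (simp add: biclique_saturated_def)
  then show ?thesis
    using E unfolding saturated_sizes_def bipartite_graph_def by fastforce
qed

end

theory Submission
  imports Defs
begin

text \<open>
  Write \<open>p = s - 1\<close>, \<open>q = t - 1\<close>, \<open>k = p + q\<close>. Every missing edge \<open>(u, u')\<close> is completed by a
  biclique between \<open>N u'\<close> and \<open>N u\<close> whose sides have sizes \<open>p, q\<close> or \<open>q, p\<close>. If some vertex has
  degree less than \<open>q\<close>, only one of the two orders is possible for its missing edges, and
  distributing each edge to one of its ends gives the bound. Otherwise all degrees are at least \<open>q\<close>,
  and one may choose \<open>u\<^sub>0\<close>, \<open>u\<^sub>0'\<close> of degree less than \<open>k\<close>, since the bound is trivial when all degrees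
  in one class are at least \<open>k\<close>. Exempt \<open>N u\<^sub>0\<close> and \<open>N u\<^sub>0'\<close>, and split every other edge equally
  between its ends, except that edges at the exempt sets, and edges from vertices that can afford it
  to vertices in need, go entirely to one end. Either every vertex receives \<open>k/2\<close>, and we are done,
  or some vertex \<open>z\<close> is left in need. In that case the completions of the missing edges at \<open>z\<close>
  show that the edges can be distributed so that nearly all vertices in the class of \<open>z\<close> receive \<open>q\<close>
  and nearly all vertices in the other class receive \<open>p\<close>.
\<close>

section \<open>Counting edges by the ends they are charged to\<close>

lemma card_relation_ge_rows:
  fixes F :: "('a \<times> 'b) set"
  assumes "finite F" and rows: "\<And>x. x \<in> X \<Longrightarrow> m \<le> card (F `` {x})"
  shows "m * card X \<le> card F"
proof (cases "finite X")
  case True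
  have fin: "finite (F `` {x})" for x
    using \<open>finite F\<close> by (simp add: finite_Image)
  have "m * card X \<le> (\<Sum>x\<in>X. card (F `` {x}))"
    using sum_mono[of X "\<lambda>_. m" "\<lambda>x. card (F `` {x})"] rows by (simp add: mult.commute)
  also have "\<dots> = card (SIGMA x:X. F `` {x})"
    using True fin by simp
  also have "\<dots> \<le> card F"
    using \<open>finite F\<close> by (intro card_mono) auto
  finally show ?thesis .
qed simp

text \<open>For weights in half edges: an edge given wholly to one end lies in both relations there.
  The tags \<open>Inl\<close> and \<open>Inr\<close> make it count twice.\<close>

lemma card_relations_ge_rows:
  fixes F G :: "('a \<times> 'b) set"
  assumes "finite F" "finite G"
    and rows: "\<And>x. x \<in> X \<Longrightarrow> m \<le> card (F `` {x}) + card (G `` {x})"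
  shows "m * card X \<le> card F + card G"
proof -
  let ?H = "(\<lambda>(x, y). (x, Inl y)) ` F \<union> (\<lambda>(x, y). (x, Inr y)) ` G :: ('a \<times> ('b + 'b)) set"
  have "m \<le> card (?H `` {x})" if "x \<in> X" for x
  proof -
    have "?H `` {x} = F `` {x} <+> G `` {x}"
      by (force simp: Plus_def)
    then show ?thesis
      using rows[OF that] assms(1,2) by (simp add: card_Plus finite_Image)
  qed
  then have "m * card X \<le> card ?H"
    using assms by (intro card_relation_ge_rows) auto
  also have "\<dots> \<le> card F + card G"
    using card_Un_le card_image_le[OF assms(1)] card_image_le[OF assms(2)]
    by (meson add_mono order_trans)
  finally show ?thesis .
qed

lemma card_relation_ge_rows_columns:
  fixes F G E :: "('a \<times> 'b) set"
  assumes "finite E" "F \<subseteq> E"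
    and rows: "\<And>x. x \<in> X \<Longrightarrow> m \<le> card (F `` {x})"
    and columns: "\<And>y. y \<in> Y \<Longrightarrow> l \<le> card ((E - F)\<inverse> `` {y})"
  shows "m * card X + l * card Y \<le> card E"
proof -
  have "m * card X \<le> card F"
    using assms by (intro card_relation_ge_rows) (auto intro: finite_subset)
  moreover have "l * card Y \<le> card ((E - F)\<inverse>)"
    using assms by (intro card_relation_ge_rows) auto
  moreover have "card E = card F + card (E - F)"
    using assms by (metis card_Diff_subset card_mono finite_subset le_add_diff_inverse)
  ultimately show ?thesis
    by simp
qed

section \<open>Completions of missing edges; vertices of low degree\<close>

definition completable :: "('a \<times> 'b) set \<Rightarrow> nat \<Rightarrow> nat \<Rightarrow> 'a \<Rightarrow> 'b \<Rightarrow> bool" where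
  "completable E a b u u' \<longleftrightarrow>
     (\<exists>A B. card A = a \<and> card B = b \<and> A \<subseteq> E\<inverse> `` {u'} \<and> B \<subseteq> E `` {u} \<and> A \<times> B \<subseteq> E)"

lemma completable_converse: "completable (E\<inverse>) a b u' u \<longleftrightarrow> completable E b a u u'"
  unfolding completable_def converse_converse by blast

locale saturated_graph =
  fixes p q n :: nat and U :: "'a set" and U' :: "'b set" and E :: "('a \<times> 'b) set"
  assumes le: "p \<le> q" "q \<le> n"
    and graph: "bipartite_graph n U U' E"
    and completion: "\<And>u u'. u \<in> U \<Longrightarrow> u' \<in> U' \<Longrightarrow> (u, u') \<notin> E \<Longrightarrow>
      completable E p q u u' \<or> completable E q p u u'"
begin

lemma swap: "saturated_graph p q n U' U (E\<inverse>)"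
proof
  show "bipartite_graph n U' U (E\<inverse>)"
    using graph by (auto simp: bipartite_graph_def)
  show "completable (E\<inverse>) p q u' u \<or> completable (E\<inverse>) q p u' u"
    if "u' \<in> U'" "u \<in> U" "(u', u) \<notin> E\<inverse>" for u' u
    using completion[of u u'] that by (auto simp: completable_converse)
qed (use le in auto)

lemma finite_U [simp]: "finite U" "finite U'"
  and card_U [simp]: "card U = n" "card U' = n"
  and E_subset: "E \<subseteq> U \<times> U'"
  using graph by (auto simp: bipartite_graph_def)

lemma finite_E [simp]: "finite E"
  using E_subset finite_U by (meson finite_SigmaI finite_subset)

lemma finite_Image_E [simp]: "finite (E `` A)" "finite (E\<inverse> `` B)"
  by (auto intro: finite_Image)

lemma card_Diff_U [simp]:
  "C \<subseteq> U \<Longrightarrow> card (U - C) = n - card C" "C' \<subseteq> U' \<Longrightarrow> card (U' - C') = n - card C'"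
  by (simp_all add: card_Diff_subset finite_subset[OF _ finite_U(1)] finite_subset[OF _ finite_U(2)])

lemma nhd_subset [simp]: "E `` A \<subseteq> U'" "E\<inverse> `` B \<subseteq> U"
  using E_subset by auto

lemma degree_ge: "p \<le> card (E `` {u})" if "u \<in> U"
proof (cases "E `` {u} = U'")
  case True
  then show ?thesis using le by simp
next
  case False
  then obtain u' where "u' \<in> U'" "(u, u') \<notin> E"
    using E_subset by auto
  from completion[OF \<open>u \<in> U\<close> this] show ?thesis
    using le unfolding completable_def
    by (metis card_mono finite_Image_E(1) order_trans)
qed

text \<open>A completion at \<open>u\<close> can only have its side of size \<open>p\<close> in
  \<open>?C'\<close>, so its \<open>q\<close> other vertices lie in \<open>P\<close>. Vertices of
  \<open>P\<close> can spare their edges leaving \<open>?C'\<close>, since \<open>p\<close> edges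
  into \<open>?C'\<close> remain.\<close>

lemma bound_if_low_degree:
  assumes u: "u \<in> U" and low: "card (E `` {u}) < q"
  shows "(p + q) * n \<le> card E + (p + q)\<^sup>2"
proof -
  let ?C' = "E `` {u}"
  define P where "P = {v \<in> U. p \<le> card (E `` {v} \<inter> ?C')}"
  define F where "F = {(v, v') \<in> E. v \<in> P \<longrightarrow> v' \<in> ?C'}"
  have "p * card U + q * card (U' - ?C') \<le> card E"
  proof (rule card_relation_ge_rows_columns)
    fix v assume "v \<in> U"
    show "p \<le> card (F `` {v})"
    proof (cases "v \<in> P")
      case True
      then have "F `` {v} = E `` {v} \<inter> ?C'"
        by (auto simp: F_def)
      with True show ?thesis by (simp add: P_def)
    next
      case False
      then have "F `` {v} = E `` {v}"
        by (auto simp: F_def)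
      with degree_ge[OF \<open>v \<in> U\<close>] show ?thesis by simp
    qed
  next
    fix v' assume v': "v' \<in> U' - ?C'"
    have "\<not> completable E p q u v'"
      using low by (auto simp: completable_def) (metis card_mono finite_Image_E(1) not_less)
    with completion[of u v'] u v' obtain A B
      where AB: "card A = q" "card B = p" "A \<subseteq> E\<inverse> `` {v'}" "B \<subseteq> ?C'" "A \<times> B \<subseteq> E"
      by (auto simp: completable_def)
    have "a \<in> P" if "a \<in> A" for a
    proof -
      have "B \<subseteq> E `` {a} \<inter> ?C'"
        using AB that by auto
      then have "p \<le> card (E `` {a} \<inter> ?C')"
        using AB(2) by (metis card_mono finite_Image_E(1) finite_Int)
      then show ?thesis
        using AB(3) that E_subset by (auto simp: P_def)
    qed
    then have "A \<subseteq> (E - F)\<inverse> `` {v'}"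
      using AB(3) v' by (auto simp: F_def)
    then show "q \<le> card ((E - F)\<inverse> `` {v'})"
      using AB(1) by (metis card_mono finite_Diff finite_E finite_Image finite_converse)
  qed (auto simp: F_def)
  then have "p * n + q * (n - card ?C') \<le> card E"
    by simp
  moreover have "q * n \<le> q * (n - card ?C') + q * card ?C'"
    by (simp add: diff_mult_distrib2)
  moreover have "q * card ?C' \<le> (p + q) * (p + q)"
    using low by (intro mult_mono) auto
  ultimately show ?thesis
    by (simp add: power2_eq_square distrib_right)
qed

end

section \<open>Vertices in need, relative to two base vertices\<close>

locale based_saturated_graph = saturated_graph p q n U U' E
  for p q n and U :: "'a set" and U' :: "'b set" and E +
  fixes u\<^sub>0 :: 'a and u\<^sub>0' :: 'b
  assumes base: "u\<^sub>0 \<in> U" "u\<^sub>0' \<in> U'"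
    and base_degree: "card (E `` {u\<^sub>0}) < p + q" "card (E\<inverse> `` {u\<^sub>0'}) < p + q"
    and min_degree: "\<And>u. u \<in> U \<Longrightarrow> q \<le> card (E `` {u})"
      "\<And>u'. u' \<in> U' \<Longrightarrow> q \<le> card (E\<inverse> `` {u'})"
begin

lemma based_swap: "based_saturated_graph p q n U' U (E\<inverse>) u\<^sub>0' u\<^sub>0"
proof -
  interpret sw: saturated_graph p q n U' U "E\<inverse>" by (rule swap)
  show ?thesis
    using base base_degree min_degree by unfold_locales auto
qed

abbreviation C where "C \<equiv> E\<inverse> `` {u\<^sub>0'}"
abbreviation C' where "C' \<equiv> E `` {u\<^sub>0}"

definition P' where "P' = {u' \<in> U'. p \<le> card (E\<inverse> `` {u'} \<inter> C)}"
definition X' where "X' = {u' \<in> U'. q \<le> card (E\<inverse> `` {u'} \<inter> C)}"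
text \<open>In half edges, each vertex outside \<open>C\<close> or \<open>C'\<close> needs
  \<open>p + q\<close>; the degree counts every edge once, and the second summand adds one for each
  edge received whole. Outside \<open>C'\<close>, a vertex of \<open>X'\<close> can give up its
  edges from outside \<open>C\<close>: its \<open>q\<close> whole edges from \<open>C\<close> weigh
  \<open>2 * q\<close>.\<close>

definition W0 where "W0 = {u \<in> U - C. card (E `` {u}) + card (E `` {u} \<inter> C') < p + q}"
definition W where "W = {u \<in> U - C. card (E `` {u}) + card (E `` {u} \<inter> (C' \<union> X')) < p + q}"

text \<open>\<open>R'\<close> consists of the vertices that can afford to give up all their edges to \<open>W\<close>.\<close>

definition R' where "R' = {u' \<in> P' - C'. q \<le> card (E\<inverse> `` {u'} - W)}"
definition S where "S = {u \<in> W. card (E `` {u}) + card (E `` {u} \<inter> (C' \<union> R')) < p + q}"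

text \<open>The edges whose full weight goes to their end in \<open>U\<close>.\<close>

definition full where
  "full = {(u, u') \<in> E. u \<notin> C \<and> (u' \<in> C' \<or> u \<in> W0 \<and> u' \<in> X' \<or> u \<in> W \<and> u' \<in> R')}"

lemma W_degree_P': "q \<le> card (E `` {w} \<inter> P')" if w: "w \<in> W"
proof -
  have wU: "w \<in> U" "(w, u\<^sub>0') \<notin> E"
    using w by (auto simp: W_def)
  have fin: "finite (E\<inverse> `` {b} \<inter> C)" for b
    by simp
  have "\<not> completable E q p w u\<^sub>0'"
  proof
    assume "completable E q p w u\<^sub>0'"
    then obtain A B where AB: "card A = q" "card B = p" "A \<subseteq> C" "B \<subseteq> E `` {w}" "A \<times> B \<subseteq> E"
      by (auto simp: completable_def)
    have "B \<subseteq> X'"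
    proof
      fix b assume b: "b \<in> B"
      then have "A \<subseteq> E\<inverse> `` {b} \<inter> C" using AB by auto
      then have "q \<le> card (E\<inverse> `` {b} \<inter> C)" using AB(1) fin card_mono by metis
      with b AB(4) E_subset show "b \<in> X'" by (auto simp: X'_def)
    qed
    then have "card B \<le> card (E `` {w} \<inter> (C' \<union> X'))"
      using AB(4) by (intro card_mono) auto
    with min_degree(1)[OF wU(1)] AB(2) w show False
      by (auto simp: W_def)
  qed
  with completion[of w "u\<^sub>0'"] wU base obtain A B
    where AB: "card A = p" "card B = q" "A \<subseteq> C" "B \<subseteq> E `` {w}" "A \<times> B \<subseteq> E"
    by (auto simp: completable_def)
  have "B \<subseteq> P'"
  proof
    fix b assume b: "b \<in> B"
    then have "A \<subseteq> E\<inverse> `` {b} \<inter> C" using AB by auto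
    then have "p \<le> card (E\<inverse> `` {b} \<inter> C)" using AB(1) fin card_mono by metis
    with b AB(4) E_subset show "b \<in> P'" by (auto simp: P'_def)
  qed
  then have "card B \<le> card (E `` {w} \<inter> P')"
    using AB(4) by (intro card_mono) auto
  with AB(2) show ?thesis by simp
qed

text \<open>Otherwise more than \<open>q - p\<close> vertices of the side \<open>A\<close> avoid
  \<open>W\<close> and \<open>C\<close>. Together with \<open>p\<close> neighbours in
  \<open>C\<close>, they give each vertex of \<open>B\<close> in \<open>P'\<close> at least
  \<open>q\<close> neighbours outside \<open>W\<close>, which puts it in \<open>C'\<close> or
  \<open>R'\<close>.\<close>

lemma S_completion:
  assumes z: "z \<in> S" and u': "u' \<in> U'" "u' \<notin> P'" and compl: "completable E q p z u'"
  shows "p \<le> card (E\<inverse> `` {u'} \<inter> (W \<union> C))"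
proof (rule ccontr)
  assume few: "\<not> ?thesis"
  from compl obtain A B
    where AB: "card A = q" "card B = p" "A \<subseteq> E\<inverse> `` {u'}" "B \<subseteq> E `` {z}" "A \<times> B \<subseteq> E"
    by (auto simp: completable_def)
  have finA: "finite A" and finB: "finite B"
    using AB(3,4) finite_Image_E finite_subset by blast+
  have "card (A \<inter> (W \<union> C)) \<le> card (E\<inverse> `` {u'} \<inter> (W \<union> C))"
    using AB(3) by (intro card_mono) auto
  moreover have "card A = card (A \<inter> (W \<union> C)) + card (A - (W \<union> C))"
    using finA by (metis Int_Diff_Un Int_Diff_disjoint card_Un_disjoint finite_Diff finite_Int)
  ultimately have A_out: "q \<le> p + card (A - (W \<union> C))"
    using few AB(1) by linarith
  have "B \<inter> P' \<subseteq> E `` {z} \<inter> (C' \<union> R')"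
  proof
    fix b assume b: "b \<in> B \<inter> P'"
    have "card (A - (W \<union> C)) + card (E\<inverse> `` {b} \<inter> C) = card ((A - (W \<union> C)) \<union> (E\<inverse> `` {b} \<inter> C))"
      using finA by (intro card_Un_disjoint[symmetric]) auto
    also have "\<dots> \<le> card (E\<inverse> `` {b} - W)"
      using b AB(5) by (intro card_mono) (auto simp: W_def)
    finally have "q \<le> card (E\<inverse> `` {b} - W)"
      using A_out b by (auto simp: P'_def)
    with b AB(4) show "b \<in> E `` {z} \<inter> (C' \<union> R')"
      by (auto simp: R'_def)
  qed
  \<comment> \<open>The degree of \<open>z\<close> is at least \<open>q + card (B - P')\<close>, and
    its whole edges number at least \<open>card (B \<inter> P')\<close>: in total
    \<open>p + q\<close>, too much for \<open>S\<close>.\<close>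
  then have "card (B \<inter> P') \<le> card (E `` {z} \<inter> (C' \<union> R'))"
    by (intro card_mono) auto
  moreover have "card (B - P') \<le> card (E `` {z} - P')"
    using AB(4) by (intro card_mono) auto
  moreover have "card B = card (B \<inter> P') + card (B - P')"
    using finB by (metis Int_Diff_Un Int_Diff_disjoint card_Un_disjoint finite_Diff finite_Int)
  moreover have "card (E `` {z}) = card (E `` {z} \<inter> P') + card (E `` {z} - P')"
    by (metis Int_Diff_Un Int_Diff_disjoint card_Un_disjoint finite_Diff finite_Int finite_Image_E(1))
  moreover have "q \<le> card (E `` {z} \<inter> P')"
    using z by (intro W_degree_P') (auto simp: S_def)
  ultimately show False
    using z AB(2) by (auto simp: S_def)
qed

section \<open>The bound when a vertex is left in need\<close>

lemma bound_if_S_nonempty: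
  assumes z: "z \<in> S"
  shows "(p + q) * n \<le> card E + (p + q)\<^sup>2"
proof -
  let ?D = "E `` {z}"
  define X where "X = {u \<in> U. q \<le> card (E `` {u} \<inter> ?D)}"
  \<comment> \<open>Vertices of \<open>X\<close> keep \<open>q\<close> edges into \<open>?D\<close>,
    those of \<open>W\<close> keep \<open>q\<close> into \<open>P'\<close>. In return a vertex
    outside \<open>?D\<close> receives all its edges from \<open>C\<close> and \<open>X\<close>, and
    also those from \<open>W\<close> if it is outside \<open>P'\<close>.\<close>
  define F where
    "F = {(u, u') \<in> E. u \<notin> C \<and> (u \<in> X \<longrightarrow> u' \<in> ?D) \<and> (u \<in> W - X \<longrightarrow> u' \<in> P')}"
  have zU: "z \<in> U" and zlow: "card ?D < p + q"
    using z by (auto simp: S_def W_def)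
  have "q * card (U - C) + p * card (U' - ?D) \<le> card E"
  proof (rule card_relation_ge_rows_columns)
    fix u assume u: "u \<in> U - C"
    consider "u \<in> X" | "u \<in> W - X" | "u \<notin> X" "u \<notin> W" by blast
    then show "q \<le> card (F `` {u})"
    proof cases
      case 1
      then have "F `` {u} = E `` {u} \<inter> ?D" using u by (auto simp: F_def)
      with 1 show ?thesis by (simp add: X_def)
    next
      case 2
      then have "F `` {u} = E `` {u} \<inter> P'" using u by (auto simp: F_def)
      with 2 show ?thesis by (simp add: W_degree_P')
    next
      case 3
      then have "F `` {u} = E `` {u}" using u by (auto simp: F_def)
      with u show ?thesis by (simp add: min_degree)
    qed
  next
    fix u' assume u': "u' \<in> U' - ?D"
    have enough: "p \<le> card ((E - F)\<inverse> `` {u'})"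
      if "p \<le> card A" "A \<subseteq> (E - F)\<inverse> `` {u'}" for A
      using that
      by (meson card_mono finite_Diff finite_E finite_Image finite_converse order_trans)
    consider "u' \<in> P'" | "completable E p q z u'" | "u' \<notin> P'" "completable E q p z u'"
      using completion[OF zU, of u'] u' by auto
    then show "p \<le> card ((E - F)\<inverse> `` {u'})"
    proof cases
      case 1
      then show ?thesis
        by (intro enough[of "E\<inverse> `` {u'} \<inter> C"]) (auto simp: P'_def F_def)
    next
      case 2
      then obtain A B
        where AB: "card A = p" "card B = q" "A \<subseteq> E\<inverse> `` {u'}" "B \<subseteq> ?D" "A \<times> B \<subseteq> E"
        by (auto simp: completable_def)
      have "a \<in> X" if "a \<in> A" for a
      proof -
        have "card B \<le> card (E `` {a} \<inter> ?D)"
          using AB(4,5) that by (intro card_mono) auto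
        then show ?thesis
          using AB(2,3) that E_subset by (auto simp: X_def)
      qed
      then show ?thesis
        using AB(1,3) u' by (intro enough[of A]) (auto simp: F_def)
    next
      case 3
      have "E\<inverse> `` {u'} \<inter> (W \<union> C) \<subseteq> (E - F)\<inverse> `` {u'}"
        using 3(1) u' by (auto simp: F_def)
      moreover have "p \<le> card (E\<inverse> `` {u'} \<inter> (W \<union> C))"
        using S_completion[OF z _ 3] u' by blast
      ultimately show ?thesis by (rule enough[rotated])
    qed
  qed (auto simp: F_def)
  then have "q * (n - card C) + p * (n - card ?D) \<le> card E"
    by simp
  moreover have "q * n \<le> q * (n - card C) + q * card C" "p * n \<le> p * (n - card ?D) + p * card ?D"
    by (simp_all add: diff_mult_distrib2)
  moreover have "q * card C \<le> q * (p + q)" "p * card ?D \<le> p * (p + q)"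
    using base_degree zlow by (intro mult_left_mono; simp)+
  ultimately show ?thesis
    unfolding power2_eq_square distrib_right by linarith
qed


section \<open>The bound when no vertex is left in need\<close>

text \<open>\<open>full\<close> takes an edge away from \<open>u'\<close> only if \<open>u'\<close> keeps enough weight; \<open>row_weight\<close> is to be
  applied with the mirror image of \<open>full\<close> as \<open>G\<close>.\<close>

lemma full_affordable:
  assumes "(u, u') \<in> full" "u' \<notin> C'"
  shows "u \<notin> C \<and> p \<le> card (E\<inverse> `` {u'} \<inter> C) \<and>
    (q \<le> card (E\<inverse> `` {u'} \<inter> C) \<or> q \<le> card (E\<inverse> `` {u'} - full\<inverse> `` {u'}))"
proof (cases "u' \<in> X'")
  case True
  with assms le show ?thesis by (auto simp: full_def X'_def)
next
  case False
  with assms have u': "u \<notin> C" "u' \<in> R'" by (auto simp: full_def)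
  have "card (E\<inverse> `` {u'} - W) \<le> card (E\<inverse> `` {u'} - full\<inverse> `` {u'})"
    using False assms(2) by (intro card_mono) (auto simp: full_def)
  with u' show ?thesis by (auto simp: R'_def P'_def)
qed

lemma row_weight:
  assumes S: "S = {}" and u: "u \<in> U - C"
    and G: "\<And>u'. (u, u') \<in> G \<Longrightarrow> u' \<notin> C' \<and> p \<le> card (E `` {u} \<inter> C') \<and>
      (q \<le> card (E `` {u} \<inter> C') \<or> q \<le> card (E `` {u} - G `` {u}))"
  shows "p + q \<le> card ((E - G) `` {u}) + card (full `` {u})"
proof -
  have rows: "(E - G) `` {u} = E `` {u} - G `` {u}" by auto
  have fin: "finite (full `` {u})"
    by (rule finite_subset[of _ "E `` {u}"]) (auto simp: full_def)
  have full: "card (E `` {u} \<inter> Y) \<le> card (full `` {u})" if "E `` {u} \<inter> Y \<subseteq> full `` {u}" for Y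
    using fin that by (rule card_mono)
  have deg: "q \<le> card (E `` {u})" using u by (simp add: min_degree)
  show ?thesis
  proof (cases "u \<in> W0")
    case True
    \<comment> \<open>An edge in \<open>G\<close> would force \<open>p\<close> neighbours in
      \<open>C'\<close>; with degree at least \<open>q\<close> this contradicts
      \<open>W0\<close>.\<close>
    with deg have "G `` {u} = {}"
      using G by (fastforce simp: W0_def)
    then have row: "(E - G) `` {u} = E `` {u}" using rows by simp
    show ?thesis
    proof (cases "u \<in> W")
      case True
      then have "p + q \<le> card (E `` {u}) + card (E `` {u} \<inter> (C' \<union> R'))"
        using S by (auto simp: S_def)
      moreover have "card (E `` {u} \<inter> (C' \<union> R')) \<le> card (full `` {u})"
        using True u by (intro full) (auto simp: full_def)
      ultimately show ?thesis unfolding row by linarith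
    next
      case False
      then have "p + q \<le> card (E `` {u}) + card (E `` {u} \<inter> (C' \<union> X'))"
        using u by (auto simp: W_def)
      moreover have "card (E `` {u} \<inter> (C' \<union> X')) \<le> card (full `` {u})"
        using True u by (intro full) (auto simp: full_def)
      ultimately show ?thesis unfolding row by linarith
    qed
  next
    case False
    then have weight: "p + q \<le> card (E `` {u}) + card (E `` {u} \<inter> C')"
      using u by (auto simp: W0_def)
    have C'_full: "card (E `` {u} \<inter> C') \<le> card (full `` {u})"
      using u by (intro full) (auto simp: full_def)
    show ?thesis
    proof (cases "G `` {u} = {}")
      case True
      with weight C'_full rows show ?thesis by simp
    next
      case False
      then obtain u' where "(u, u') \<in> G" by auto
      from G[OF this] have p: "p \<le> card (E `` {u} \<inter> C')"
        and q: "q \<le> card (E `` {u} \<inter> C') \<or> q \<le> card (E `` {u} - G `` {u})"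
        by auto
      \<comment> \<open>Edges into \<open>C'\<close> are never in \<open>G\<close>, so they count
        twice: either \<open>2 * q\<close> suffices, or \<open>q\<close> kept edges and
        \<open>p\<close> second halves do.\<close>
      have "card (E `` {u} \<inter> C') \<le> card (E `` {u} - G `` {u})"
        using G by (intro card_mono) auto
      with p q C'_full le show ?thesis
        unfolding rows by linarith
    qed
  qed
qed

lemma bound_if_based: "(p + q) * n \<le> card E + (p + q)\<^sup>2"
proof -
  interpret sw: based_saturated_graph p q n U' U "E\<inverse>" "u\<^sub>0'" "u\<^sub>0"
    by (rule based_swap)
  consider "S \<noteq> {}" | "sw.S \<noteq> {}" | "S = {}" "sw.S = {}" by blast
  then show ?thesis
  proof cases
    case 1
    then show ?thesis using bound_if_S_nonempty by blast
  next
    case 2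
    then show ?thesis using sw.bound_if_S_nonempty by auto
  next
    case 3
    define G where "G = sw.full\<inverse>"
    have sub: "full \<subseteq> E" "G \<subseteq> E"
      by (auto simp: full_def sw.full_def G_def)
    then have fin: "finite full" "finite G"
      using finite_E finite_subset by blast+
    have "(p + q) * card (U - C) \<le> card (E - G) + card full"
    proof (rule card_relations_ge_rows)
      show "p + q \<le> card ((E - G) `` {u}) + card (full `` {u})" if "u \<in> U - C" for u
        using 3(1) that
      proof (rule row_weight)
        show "u' \<notin> C' \<and> p \<le> card (E `` {u} \<inter> C') \<and>
          (q \<le> card (E `` {u} \<inter> C') \<or> q \<le> card (E `` {u} - G `` {u}))" if "(u, u') \<in> G" for u'
          using sw.full_affordable[of u' u] that \<open>u \<in> U - C\<close> by (auto simp: G_def)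
      qed
    qed (use fin in auto)
    moreover have "(p + q) * card (U' - C') \<le> card (E\<inverse> - full\<inverse>) + card (G\<inverse>)"
    proof (rule card_relations_ge_rows)
      show "p + q \<le> card ((E\<inverse> - full\<inverse>) `` {u'}) + card (G\<inverse> `` {u'})" if "u' \<in> U' - C'" for u'
        unfolding G_def converse_converse using 3(2) _
      proof (rule sw.row_weight)
        show "u \<notin> C \<and> p \<le> card (E\<inverse> `` {u'} \<inter> E\<inverse> `` {u\<^sub>0'}) \<and>
          (q \<le> card (E\<inverse> `` {u'} \<inter> E\<inverse> `` {u\<^sub>0'}) \<or> q \<le> card (E\<inverse> `` {u'} - full\<inverse> `` {u'}))"
          if "(u', u) \<in> full\<inverse>" for u
          using full_affordable[of u u'] that \<open>u' \<in> U' - C'\<close> by auto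
      qed (use that in auto)
    qed (use fin in auto)
    moreover have "E\<inverse> - full\<inverse> = (E - full)\<inverse>"
      by auto
    \<comment> \<open>Over both classes, the four relations count every edge exactly twice.\<close>
    moreover have "card (E - full) + card full = card E" "card (E - G) + card G = card E"
      using sub fin by (simp_all add: card_Diff_subset card_mono)
    ultimately have total: "(p + q) * (n - card C) + (p + q) * (n - card C') \<le> 2 * card E"
      by simp
    \<comment> \<open>Exempting \<open>C\<close> and \<open>C'\<close> costs at most
      \<open>(p + q)\<^sup>2\<close> each, hence only one such term after halving.\<close>
    have slack: "(p + q) * n \<le> (p + q) * (n - c) + (p + q)\<^sup>2" if "c < p + q" for c
    proof -
      have "(p + q) * n \<le> (p + q) * ((n - c) + (p + q))"
        using that by (intro mult_left_mono) auto
      then show ?thesis by (simp add: power2_eq_square distrib_left)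
    qed
    show ?thesis
      using total slack[OF base_degree(1)] slack[OF base_degree(2)] by linarith
  qed
qed

end

section \<open>Choice of the base vertices and return to saturation\<close>

lemma (in saturated_graph) size_bound: "(p + q) * n \<le> card E + (p + q)\<^sup>2"
proof -
  interpret sw: saturated_graph p q n U' U "E\<inverse>" by (rule swap)
  show ?thesis
  proof (rule ccontr)
    assume not: "\<not> ?thesis"
    have min: "q \<le> card (E `` {u})" if "u \<in> U" for u
      using bound_if_low_degree[OF that] not by (meson not_le)
    have min': "q \<le> card (E\<inverse> `` {u'})" if "u' \<in> U'" for u'
      using sw.bound_if_low_degree[OF that] not by (metis card_inverse not_le)
    have "\<not> (p + q) * card U \<le> card E" "\<not> (p + q) * card U' \<le> card (E\<inverse>)"
      using not by simp_all
    then obtain u\<^sub>0 u\<^sub>0' where "u\<^sub>0 \<in> U" "card (E `` {u\<^sub>0}) < p + q"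
      "u\<^sub>0' \<in> U'" "card (E\<inverse> `` {u\<^sub>0'}) < p + q"
      using card_relation_ge_rows[of E U "p + q"] card_relation_ge_rows[of "E\<inverse>" U' "p + q"]
      by (metis finite_E finite_converse not_le)
    then interpret based_saturated_graph p q n U U' E "u\<^sub>0" "u\<^sub>0'"
      using min min' by unfold_locales
    show False
      using not bound_if_based by contradiction
  qed
qed

text \<open>Deleting both ends of the new edge leaves two sides joined to each other and to those
  ends by old edges.\<close>

lemma completable_if_biclique_copy:
  assumes copy: "biclique_copy s t U U' (insert (u, u') E) A B" and uu': "u \<in> A" "u' \<in> B"
    and fin: "finite U" "finite U'" and new: "(u, u') \<notin> E"
  shows "completable E (card A - 1) (card B - 1) u u'"
  unfolding completable_def
proof (intro exI conjI)
  have "finite A" "finite B"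
    using copy fin finite_subset by (auto simp: biclique_copy_def)
  with uu' show "card (A - {u}) = card A - 1" "card (B - {u'}) = card B - 1"
    by auto
qed (use copy uu' in \<open>auto simp: biclique_copy_def\<close>)

lemma saturated_graph_if_biclique_saturated:
  assumes "1 \<le> s" "s \<le> t" "t \<le> n"
    and graph: "bipartite_graph n U U' E" and sat: "biclique_saturated s t U U' E"
  shows "saturated_graph (s - 1) (t - 1) n U U' E"
proof
  fix u u' assume uu': "u \<in> U" "u' \<in> U'" "(u, u') \<notin> E"
  with sat obtain A B where AB: "biclique_copy s t U U' (insert (u, u') E) A B" "u \<in> A" "u' \<in> B"
    unfolding biclique_saturated_def by blast
  have "completable E (card A - 1) (card B - 1) u u'"
    using AB graph uu'(3) by (intro completable_if_biclique_copy[OF AB]) (auto simp: bipartite_graph_def)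
  with AB(1) show "completable E (s - 1) (t - 1) u u' \<or> completable E (t - 1) (s - 1) u u'"
    by (auto simp: biclique_copy_def)
qed (use assms in auto)

lemma biclique_saturated_size_bound:
  assumes "1 \<le> s" "s \<le> t" "t \<le> n"
    and "bipartite_graph n U U' E" "biclique_saturated s t U U' E"
  shows "(int s + int t - 2) * int n - (int s + int t - 2)\<^sup>2 \<le> int (card E)"
proof -
  interpret saturated_graph "s - 1" "t - 1" n U U' E
    using assms by (rule saturated_graph_if_biclique_saturated)
  have "int ((s - 1 + (t - 1)) * n) \<le> int (card E + (s - 1 + (t - 1))\<^sup>2)"
    using size_bound by (simp only: of_nat_le_iff)
  moreover have "int (s - 1 + (t - 1)) = int s + int t - 2"
    using assms by simp
  ultimately show ?thesis
    by (simp only: of_nat_mult of_nat_add of_nat_power)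
qed

theorem theorem1p2:
  fixes s t n :: nat
  assumes "1 \<le> s" and "s \<le> t" and "t \<le> n"
  shows "int (sat_number n s t) \<ge> (int s + int t - 2) * int n - (int s + int t - 2)\<^sup>2
    \<and> (\<forall>(U :: 'a set) (U' :: 'b set) (E :: ('a \<times> 'b) set).
          bipartite_graph n U U' E \<longrightarrow> biclique_saturated s t U U' E \<longrightarrow>
          int (card E) \<ge> (int s + int t - 2) * int n - (int s + int t - 2)\<^sup>2)"
proof -
  have "sat_number n s t \<in> saturated_sizes n s t"
    unfolding sat_number_def using assms
    by (intro Min_in finite_saturated_sizes saturated_sizes_nonempty) auto
  then obtain E :: "(nat \<times> nat) set" where "sat_number n s t = card E"
    "bipartite_graph n {..<n} {..<n} E" "biclique_saturated s t {..<n} {..<n} E"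
    by (auto simp: saturated_sizes_def)
  then have "int (sat_number n s t) \<ge> (int s + int t - 2) * int n - (int s + int t - 2)\<^sup>2"
    using biclique_saturated_size_bound[OF assms] by metis
  then show ?thesis
    using biclique_saturated_size_bound[OF assms] by blast
qed

end
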